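(* For every non-negative integer $n$, $$\mathcal{T}_{-n}=A_{3}\alpha^{-n}+B_{3}\beta^{-n}+C_{3}\gamma^{-n},\qquad \mathcal{K}_{-n}=A_{4}\alpha^{-n}+B_{4}\beta^{-n}+C_{4}\gamma^{-n},$$ where $$A_{3}=\frac{\alpha\mathcal{T}_{-2}+(\alpha-1)\alpha^{2}\mathcal{T}_{-1}+\alpha^{2}\mathcal{T}_{0}}{(\alpha-\gamma)(\alpha-\beta)},\quad B_{3}=\frac{\beta\mathcal{T}_{-2}+(\beta-1)\beta^{2}\mathcal{T}_{-1}+\beta^{2}\mathcal{T}_{0}}{(\beta-\gamma)(\beta-\alpha)},\quad C_{3}=\frac{\gamma\mathcal{T}_{-2}+(\gamma-1)\gamma^{2}\mathcal{T}_{-1}+\gamma^{2}\mathcal{T}_{0}}{(\gamma-\beta)(\gamma-\alpha)},$$ $$A_{4}=\frac{\alpha\mathcal{K}_{-2}+(\alpha-1)\alpha^{2}\mathcal{K}_{-1}+\alpha^{2}\mathcal{K}_{0}}{(\alpha-\gamma)(\alpha-\beta)},\quad B_{4}=\frac{\beta\mathcal{K}_{-2}+(\beta-1)\beta^{2}\mathcal{K}_{-1}+\beta^{2}\mathcal{K}_{0}}{(\beta-\gamma)(\beta-\alpha)},\quad C_{4}=\frac{\gamma\mathcal{K}_{-2}+(\gamma-1)\gamma^{2}\mathcal{K}_{-1}+\gamma^{2}\mathcal{K}_{0}}{(\gamma-\beta)(\gamma-\alpha)}.$$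
   Context: $\alpha,\beta,\gamma$ are the three (distinct) complex roots of $x^{3}-x^{2}-x-1=0$. The negative-index Tribonacci matrix sequence $(\mathcal{T}_{-n})_{n\ge 0}$ and Tribonacci-Lucas matrix sequence $(\mathcal{K}_{-n})_{n\ge 0}$ are the sequences of $3\times 3$ matrices defined, for $n\ge 3$, by $\mathcal{T}_{-n}=\mathcal{T}_{-n+3}-\mathcal{T}_{-n+2}-\mathcal{T}_{-n+1}$ and $\mathcal{K}_{-n}=\mathcal{K}_{-n+3}-\mathcal{K}_{-n+2}-\mathcal{K}_{-n+1}$, with initial conditions $$\mathcal{T}_{0}=I_3,\quad \mathcal{T}_{-1}=\begin{pmatrix}0&1&0\\0&0&1\\1&-1&-1\end{pmatrix},\quad \mathcal{T}_{-2}=\begin{pmatrix}0&0&1\\1&-1&-1\\-1&2&0\end{pmatrix},$$ $$\mathcal{K}_{0}=\begin{pmatrix}1&2&3\\3&-2&-1\\-1&4&-1\end{pmatrix},\quad \mathcal{K}_{-1}=\begin{pmatrix}3&-2&-1\\-1&4&-1\\-1&0&5\end{pmatrix},\quad \mathcal{K}_{-2}=\begin{pmatrix}-1&4&-1\\-1&0&5\\5&-6&-5\end{pmatrix}.$$ *)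

theory Defs
  imports "HOL-Analysis.Analysis"
begin

text \<open>The argument is the negated index: \<open>trib_neg n\<close> stands for \<open>T\<^sub>-\<^sub>n\<close> and \<open>trib_lucas_neg n\<close> for
  \<open>K\<^sub>-\<^sub>n\<close>. The recurrence \<open>X\<^sub>-\<^sub>n = X\<^sub>-\<^sub>n\<^sub>+\<^sub>3 - X\<^sub>-\<^sub>n\<^sub>+\<^sub>2 - X\<^sub>-\<^sub>n\<^sub>+\<^sub>1\<close> for \<open>n \<ge> 3\<close> is written with \<open>n\<close> shifted by 3.
  The entries are taken in the complex numbers, and matrices are listed by rows.\<close>

fun trib_neg :: "nat \<Rightarrow> complex^3^3" where
  "trib_neg 0 = mat 1"
| "trib_neg (Suc 0) = vector [vector [0, 1, 0], vector [0, 0, 1], vector [1, -1, -1]]"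
| "trib_neg (Suc (Suc 0)) = vector [vector [0, 0, 1], vector [1, -1, -1], vector [-1, 2, 0]]"
| "trib_neg (Suc (Suc (Suc n))) = trib_neg n - trib_neg (Suc n) - trib_neg (Suc (Suc n))"

fun trib_lucas_neg :: "nat \<Rightarrow> complex^3^3" where
  "trib_lucas_neg 0 = vector [vector [1, 2, 3], vector [3, -2, -1], vector [-1, 4, -1]]"
| "trib_lucas_neg (Suc 0) = vector [vector [3, -2, -1], vector [-1, 4, -1], vector [-1, 0, 5]]"
| "trib_lucas_neg (Suc (Suc 0)) = vector [vector [-1, 4, -1], vector [-1, 0, 5], vector [5, -6, -5]]"
| "trib_lucas_neg (Suc (Suc (Suc n))) =
    trib_lucas_neg n - trib_lucas_neg (Suc n) - trib_lucas_neg (Suc (Suc n))"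

text \<open>Multiplication of a matrix by a complex scalar; \<open>*s\<close> on \<open>complex^3^3\<close> would take its scalar
  from \<open>complex^3\<close>, and \<open>*\<^sub>R\<close> only a real one.\<close>

definition smult_matrix :: "complex \<Rightarrow> complex^'n^'m \<Rightarrow> complex^'n^'m" (infixr "*\<^sub>M" 75) where
  "c *\<^sub>M A = map_matrix (\<lambda>x. c * x) A"

text \<open>The coefficient of \<open>x\<^sup>-\<^sup>n\<close>, where \<open>y\<close>, \<open>z\<close> are the other two roots and \<open>X n\<close> is the term of
  index \<open>-n\<close>.\<close>

definition binet_coeff :: "(nat \<Rightarrow> complex^3^3) \<Rightarrow> complex \<Rightarrow> complex \<Rightarrow> complex \<Rightarrow> complex^3^3" where
  "binet_coeff X x y z =
    (1 / ((x - y) * (x - z))) *\<^sub>M (x *\<^sub>M X 2 + ((x - 1) * x^2) *\<^sub>M X 1 + x^2 *\<^sub>M X 0)"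

end

theory Submission
  imports Defs
begin

text \<open>
  Every entry of either matrix sequence is a scalar sequence \<open>u\<close> with
  \<open>u (n + 3) = u n - u (n + 1) - u (n + 2)\<close>, whose characteristic roots are the inverses of the
  roots \<open>x\<close> of \<open>x\<^sup>3 = x\<^sup>2 + x + 1\<close>. A combination of the \<open>x\<^sup>-\<^sup>n\<close> satisfies the same recurrence, so
  only the indices 0, 1 and 2 have to be compared.

  There the formula becomes a statement about the sums \<open>S\<^sub>k\<close> of \<open>x\<^sup>k / ((x - y) (x - z))\<close> over the three
  roots, \<open>y\<close> and \<open>z\<close> being the other two. These are second divided differences of \<open>x\<^sup>k\<close>, so
  \<open>S\<^sub>0 = S\<^sub>1 = 0\<close> and \<open>S\<^sub>2 = 1\<close> for any three distinct numbers. The cubic gives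
  \<open>S\<^sub>3 = S\<^sub>2 + S\<^sub>1 + S\<^sub>0 = 1\<close> and, read backwards, \<open>S\<^sub>-\<^sub>1 = S\<^sub>2 - S\<^sub>1 - S\<^sub>0 = 1\<close>. These five values make the
  coefficients of \<open>u 0\<close>, \<open>u 1\<close>, \<open>u 2\<close> come out as 0 or 1.

  The scalar argument is \<open>reversed_tribonacci_binet\<close>; the values \<open>S\<^sub>0\<close>, \<open>S\<^sub>1\<close>, \<open>S\<^sub>2\<close> are
  \<open>divided_difference_monomials\<close>, and \<open>inverse_tribonacci_root\<close> is what gives \<open>S\<^sub>-\<^sub>1\<close>.
\<close>

text \<open>
  The second divided difference of a polynomial at three points is the coefficient of \<open>x\<^sup>2\<close> in its
  quadratic interpolant, which is the polynomial itself for \<open>1\<close>, \<open>x\<close> and \<open>x\<^sup>2\<close>.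
\<close>

lemma divided_difference_monomials:
  fixes a b c :: "'a::field"
  assumes "a \<noteq> b" "a \<noteq> c" "b \<noteq> c"
  shows "1 / ((a - c) * (a - b)) + 1 / ((b - c) * (b - a)) + 1 / ((c - b) * (c - a)) = 0"
    and "a / ((a - c) * (a - b)) + b / ((b - c) * (b - a)) + c / ((c - b) * (c - a)) = 0"
    and "a^2 / ((a - c) * (a - b)) + b^2 / ((b - c) * (b - a)) + c^2 / ((c - b) * (c - a)) = 1"
proof -
  have nz: "a - b \<noteq> 0" "a - c \<noteq> 0" "b - c \<noteq> 0"
    using assms by auto
  \<comment> \<open>Only three differences should occur in the denominators.\<close>
  have swap: "b - a = - (a - b)" "c - a = - (a - c)" "c - b = - (b - c)"
    by simp_all
  have comb: "p / ((a - c) * (a - b)) + q / ((b - c) * (b - a)) + r / ((c - b) * (c - a))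
      = (p * (b - c) - q * (a - c) + r * (a - b)) / ((a - b) * (a - c) * (b - c))" for p q r
    unfolding swap using nz by (simp add: divide_simps) (simp add: algebra_simps)
  show "1 / ((a - c) * (a - b)) + 1 / ((b - c) * (b - a)) + 1 / ((c - b) * (c - a)) = 0"
    unfolding comb by simp
  show "a / ((a - c) * (a - b)) + b / ((b - c) * (b - a)) + c / ((c - b) * (c - a)) = 0"
    unfolding comb by (simp add: algebra_simps)
  have "a^2 * (b - c) - b^2 * (a - c) + c^2 * (a - b) = (a - b) * (a - c) * (b - c)"
    by (simp add: algebra_simps power2_eq_square)
  then show "a^2 / ((a - c) * (a - b)) + b^2 / ((b - c) * (b - a)) + c^2 / ((c - b) * (c - a)) = 1"
    unfolding comb using nz by simp
qed

lemma inverse_tribonacci_root: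
  fixes x :: "'a::field"
  assumes "x^3 = x^2 + x + 1"
  shows "x \<noteq> 0" and "inverse x = x^2 - x - 1"
proof -
  show "x \<noteq> 0"
    using assms by auto
  moreover have "x * (x^2 - x - 1) = 1"
    using assms by (simp add: algebra_simps power2_eq_square power3_eq_cube)
  ultimately show "inverse x = x^2 - x - 1"
    by (metis inverse_unique)
qed

lemma inverse_power_recurrence:
  fixes x :: "'a::field"
  assumes "x^3 = x^2 + x + 1"
  shows "inverse x ^ Suc (Suc (Suc n)) = inverse x ^ n - inverse x ^ Suc n - inverse x ^ Suc (Suc n)"
proof -
  let ?i = "inverse x"
  have one: "x * ?i = 1"
    using inverse_tribonacci_root(1)[OF assms] by simp
  \<comment> \<open>Dividing the cubic by \<open>x\<^sup>3\<close> gives the reversed cubic for the inverse of \<open>x\<close>.\<close>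
  have "?i^3 * x^3 = ?i^3 * (x^2 + x + 1)"
    using assms by simp
  with one have "?i^3 = 1 - ?i - ?i^2"
    by algebra
  then have "?i^n * ?i^3 = ?i^n * (1 - ?i - ?i^2)"
    by simp
  then show ?thesis
    by (simp add: algebra_simps power2_eq_square power3_eq_cube)
qed

text \<open>
  The numerator \<open>w x\<close> is chosen so that, after division by \<open>x\<^sup>n\<close> and summation over the roots with
  weights \<open>1 / ((x - y) (x - z))\<close>, it isolates \<open>u n\<close> for each of \<open>n = 0, 1, 2\<close>.
\<close>

lemma reversed_tribonacci_binet:
  fixes a b c :: "'a::field" and u :: "nat \<Rightarrow> 'a"
  assumes distinct: "a \<noteq> b" "a \<noteq> c" "b \<noteq> c"
    and roots: "a^3 = a^2 + a + 1" "b^3 = b^2 + b + 1" "c^3 = c^2 + c + 1"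
    and rec: "\<And>n. u (Suc (Suc (Suc n))) = u n - u (Suc n) - u (Suc (Suc n))"
  defines "w \<equiv> \<lambda>x. x * u 2 + (x - 1) * x^2 * u 1 + x^2 * u 0"
  shows "u n = inverse a ^ n * (w a / ((a - c) * (a - b)))
             + inverse b ^ n * (w b / ((b - c) * (b - a)))
             + inverse c ^ n * (w c / ((c - b) * (c - a)))"
proof -
  define p where "p = 1 / ((a - c) * (a - b))"
  define q where "q = 1 / ((b - c) * (b - a))"
  define r where "r = 1 / ((c - b) * (c - a))"
  have S0: "p + q + r = 0"
    and S1: "a * p + b * q + c * r = 0"
    and S2: "a^2 * p + b^2 * q + c^2 * r = 1"
    using divided_difference_monomials[OF distinct] by (simp_all add: p_def q_def r_def)
  have S3: "a^3 * p + b^3 * q + c^3 * r = 1"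
    unfolding roots using S0 S1 S2 by algebra
  have Sm1: "inverse a * p + inverse b * q + inverse c * r = 1"
    unfolding roots[THEN inverse_tribonacci_root(2)] using S0 S1 S2 by algebra
  have inv: "inverse a * a = 1" "inverse b * b = 1" "inverse c * c = 1"
    using roots[THEN inverse_tribonacci_root(1)] by simp_all
  have "u n = inverse a ^ n * (w a * p) + inverse b ^ n * (w b * q) + inverse c ^ n * (w c * r)"
  \<comment> \<open>The recursion of \<open>trib_neg\<close> provides the induction scheme of a third-order recurrence.\<close>
  proof (induction n rule: trib_neg.induct)
    case 1
    \<comment> \<open>At index \<open>n\<close> the weights \<open>w\<close> are shifted down by \<open>n\<close> powers: here the coefficients of \<open>u 2\<close>,
      \<open>u 1\<close>, \<open>u 0\<close> are \<open>S\<^sub>1\<close>, \<open>S\<^sub>3 - S\<^sub>2\<close>, \<open>S\<^sub>2\<close>, and each further index lowers all subscripts by one.\<close>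
    have "w a * p + w b * q + w c * r
        = (a * p + b * q + c * r) * u 2
          + ((a^3 * p + b^3 * q + c^3 * r) - (a^2 * p + b^2 * q + c^2 * r)) * u 1
          + (a^2 * p + b^2 * q + c^2 * r) * u 0"
      unfolding w_def by algebra
    then show ?case
      using S1 S2 S3 by simp
  next
    case 2
    have "inverse a * w a = u 2 + (a^2 - a) * u 1 + a * u 0"
      "inverse b * w b = u 2 + (b^2 - b) * u 1 + b * u 0"
      "inverse c * w c = u 2 + (c^2 - c) * u 1 + c * u 0"
      unfolding w_def using inv by algebra+
    then have "inverse a * (w a * p) + inverse b * (w b * q) + inverse c * (w c * r)
        = (p + q + r) * u 2
          + ((a^2 * p + b^2 * q + c^2 * r) - (a * p + b * q + c * r)) * u 1
          + (a * p + b * q + c * r) * u 0"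
      by algebra
    then show ?case
      using S0 S1 S2 by simp
  next
    case 3
    have "inverse a ^ 2 * w a = inverse a * u 2 + (a - 1) * u 1 + u 0"
      "inverse b ^ 2 * w b = inverse b * u 2 + (b - 1) * u 1 + u 0"
      "inverse c ^ 2 * w c = inverse c * u 2 + (c - 1) * u 1 + u 0"
      unfolding w_def using inv by algebra+
    then have "inverse a ^ 2 * (w a * p) + inverse b ^ 2 * (w b * q) + inverse c ^ 2 * (w c * r)
        = (inverse a * p + inverse b * q + inverse c * r) * u 2
          + ((a * p + b * q + c * r) - (p + q + r)) * u 1
          + (p + q + r) * u 0"
      by algebra
    then have "inverse a ^ 2 * (w a * p) + inverse b ^ 2 * (w b * q) + inverse c ^ 2 * (w c * r)
        = u 2"
      using S0 S1 Sm1 by simp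
    then show ?case
      by (simp add: numeral_2_eq_2)
  next
    case (4 n)
    show ?case
      unfolding rec "4.IH" roots[THEN inverse_power_recurrence] by (simp only: algebra_simps)
  qed
  then show ?thesis
    by (simp add: p_def q_def r_def)
qed

lemma smult_matrix_nth [simp]: "(k *\<^sub>M A) $ i $ j = k * A $ i $ j"
  by (simp add: smult_matrix_def map_matrix_def)

lemma reversed_tribonacci_binet_matrix:
  fixes X :: "nat \<Rightarrow> complex^3^3"
  assumes "a \<noteq> b" "a \<noteq> c" "b \<noteq> c"
    and "a^3 = a^2 + a + 1" "b^3 = b^2 + b + 1" "c^3 = c^2 + c + 1"
    and rec: "\<And>n. X (Suc (Suc (Suc n))) = X n - X (Suc n) - X (Suc (Suc n))"
  shows "X n = (a powi (- int n)) *\<^sub>M binet_coeff X a c b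
             + (b powi (- int n)) *\<^sub>M binet_coeff X b c a
             + (c powi (- int n)) *\<^sub>M binet_coeff X c b a"
proof -
  have "X n $ i $ j = ((a powi (- int n)) *\<^sub>M binet_coeff X a c b
             + (b powi (- int n)) *\<^sub>M binet_coeff X b c a
             + (c powi (- int n)) *\<^sub>M binet_coeff X c b a) $ i $ j" for i j
    using reversed_tribonacci_binet[OF assms(1-6), of "\<lambda>n. X n $ i $ j" n]
    by (simp add: rec binet_coeff_def power_int_minus power_inverse)
  then show ?thesis
    by (simp add: vec_eq_iff)
qed

theorem theorem2p3:
  fixes \<alpha> \<beta> \<gamma> :: complex
    and A\<^sub>3 B\<^sub>3 C\<^sub>3 A\<^sub>4 B\<^sub>4 C\<^sub>4 :: "complex^3^3"
    and n :: nat
  assumes roots: "{x :: complex. x^3 - x^2 - x - 1 = 0} = {\<alpha>, \<beta>, \<gamma>}"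
    and distinct: "\<alpha> \<noteq> \<beta>" "\<alpha> \<noteq> \<gamma>" "\<beta> \<noteq> \<gamma>"
    and A3: "A\<^sub>3 = binet_coeff trib_neg \<alpha> \<gamma> \<beta>"
    and B3: "B\<^sub>3 = binet_coeff trib_neg \<beta> \<gamma> \<alpha>"
    and C3: "C\<^sub>3 = binet_coeff trib_neg \<gamma> \<beta> \<alpha>"
    and A4: "A\<^sub>4 = binet_coeff trib_lucas_neg \<alpha> \<gamma> \<beta>"
    and B4: "B\<^sub>4 = binet_coeff trib_lucas_neg \<beta> \<gamma> \<alpha>"
    and C4: "C\<^sub>4 = binet_coeff trib_lucas_neg \<gamma> \<beta> \<alpha>"
  shows "trib_neg n =
           (\<alpha> powi (- int n)) *\<^sub>M A\<^sub>3 + (\<beta> powi (- int n)) *\<^sub>M B\<^sub>3 + (\<gamma> powi (- int n)) *\<^sub>M C\<^sub>3 \<and>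
         trib_lucas_neg n =
           (\<alpha> powi (- int n)) *\<^sub>M A\<^sub>4 + (\<beta> powi (- int n)) *\<^sub>M B\<^sub>4 + (\<gamma> powi (- int n)) *\<^sub>M C\<^sub>4"
proof -
  have "x^3 = x^2 + x + 1" if "x \<in> {\<alpha>, \<beta>, \<gamma>}" for x
    using that unfolding roots[symmetric] by (simp add: algebra_simps)
  then have "\<alpha>^3 = \<alpha>^2 + \<alpha> + 1" "\<beta>^3 = \<beta>^2 + \<beta> + 1" "\<gamma>^3 = \<gamma>^2 + \<gamma> + 1"
    by simp_all
  note binet = reversed_tribonacci_binet_matrix[OF distinct this]
  show ?thesis
    unfolding A3 B3 C3 A4 B4 C4
    using binet[of trib_neg, OF trib_neg.simps(4)]
      binet[of trib_lucas_neg, OF trib_lucas_neg.simps(4)]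
    by blast
qed

end
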